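(* For every integer $n\geq 1$, $$A_{n}(t)=\left(\frac{1+yt}{1+y}\right)^{n+1}P_{n}^{(\mathrm{pk},\mathrm{des})}\left(\frac{(1+y)^{2}t}{(y+t)(1+yt)},\frac{y+t}{1+yt}\right).$$ Equivalently, $$P_{n}^{(\mathrm{pk},\mathrm{des})}(y,t)=\left(\frac{1+u}{1+uv}\right)^{n+1}A_{n}(v),$$ where $$u=\frac{1+t^{2}-2yt-(1-t)\sqrt{(1+t)^{2}-4yt}}{2(1-y)t},\qquad v=\frac{(1+t)^{2}-2yt-(1+t)\sqrt{(1+t)^{2}-4yt}}{2yt}.$$
   Context: $\mathfrak{S}_n$ is the set of permutations $\pi=\pi_1\cdots\pi_n$ of $[n]=\{1,\dots,n\}$. For $\pi\in\mathfrak{S}_n$, $\mathrm{des}(\pi)$ is the number of descents, i.e. of $i\in[n-1]$ with $\pi_i>\pi_{i+1}$, and $\mathrm{pk}(\pi)$ is the number of peaks, i.e. of $i$ with $2\le i\le n-1$ and $\pi_{i-1}<\pi_i>\pi_{i+1}$. For $n\ge1$, the Eulerian polynomial is $A_n(t)=\sum_{\pi\in\mathfrak{S}_n}t^{\mathrm{des}(\pi)+1}$, and $P_n^{(\mathrm{pk},\mathrm{des})}(y,t)=\sum_{\pi\in\mathfrak{S}_n}y^{\mathrm{pk}(\pi)+1}t^{\mathrm{des}(\pi)+1}$. Here $y,t$ are indeterminates; the first identity is an identity of rational functions in $y,t$. In the second identity, $\sqrt{(1+t)^2-4yt}$ is the formal power series in $t$ over $\mathbb{Q}[y]$ with constant term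 $1$, so that $u$ and $v$ are formal power series in $t$ with coefficients in $\mathbb{Q}[y]$. *)

theory Defs
  imports
    "HOL-Combinatorics.Permutations"
    "HOL-Computational_Algebra.Computational_Algebra"
begin

text \<open>A permutation of \<open>[n]\<close> is a function permuting \<open>{1..n}\<close>; its one-line notation is
  \<open>\<pi> 1, \<dots>, \<pi> n\<close>.\<close>

definition des :: "nat \<Rightarrow> (nat \<Rightarrow> nat) \<Rightarrow> nat" where
  "des n \<pi> = card {i. 1 \<le> i \<and> i \<le> n - 1 \<and> \<pi> i > \<pi> (i + 1)}"

definition pk :: "nat \<Rightarrow> (nat \<Rightarrow> nat) \<Rightarrow> nat" where
  "pk n \<pi> = card {i. 2 \<le> i \<and> i \<le> n - 1 \<and> \<pi> (i - 1) < \<pi> i \<and> \<pi> i > \<pi> (i + 1)}"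

text \<open>The polynomials \<open>A\<^sub>n\<close> and \<open>P\<^sub>n\<close> have natural number coefficients; they are given by their
  values in an arbitrary commutative (semi)ring. Evaluating them at indeterminates gives the
  polynomials themselves.\<close>

definition eulerian_poly :: "nat \<Rightarrow> 'a::comm_semiring_1 \<Rightarrow> 'a" where
  "eulerian_poly n t = (\<Sum>\<pi> | \<pi> permutes {1..n}. t ^ (des n \<pi> + 1))"

definition pk_des_poly :: "nat \<Rightarrow> 'a::comm_semiring_1 \<Rightarrow> 'a \<Rightarrow> 'a" where
  "pk_des_poly n y t = (\<Sum>\<pi> | \<pi> permutes {1..n}. y ^ (pk n \<pi> + 1) * t ^ (des n \<pi> + 1))"


subsection \<open>The field of rational functions in \<open>y\<close> and \<open>t\<close>\<close>

text \<open>\<open>\<rat>(y,t)\<close> is the fraction field of \<open>\<rat>[y][t]\<close>.\<close>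

type_synonym ratfun = "rat poly poly fract"

definition y_rf :: ratfun where "y_rf = to_fract [:[:0, 1:]:]"

definition t_rf :: ratfun where "t_rf = to_fract [:0, 1:]"


subsection \<open>Power series in \<open>t\<close> over \<open>\<rat>[y]\<close>\<close>

definition y_ps :: "rat poly fps" where "y_ps = fps_const [:0, 1:]"

definition t_ps :: "rat poly fps" where "t_ps = fps_X"

definition sqrt_ps :: "rat poly fps" where
  "sqrt_ps = (THE S. S\<^sup>2 = (1 + t_ps)\<^sup>2 - 4 * y_ps * t_ps \<and> fps_nth S 0 = 1)"

text \<open>\<open>\<rat>[y][[t]]\<close> is embedded coefficientwise in the field \<open>\<rat>(y)((t))\<close> of formal Laurent series,
  where the quotients defining \<open>u\<close> and \<open>v\<close> can be formed.\<close>

type_synonym laurent = "rat poly fract fls"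

definition embed_ps :: "rat poly fps \<Rightarrow> laurent" where
  "embed_ps f = fps_to_fls (Abs_fps (\<lambda>n. to_fract (fps_nth f n)))"

definition y_ls :: laurent where "y_ls = embed_ps y_ps"

definition t_ls :: laurent where "t_ls = embed_ps t_ps"

definition sqrt_ls :: laurent where "sqrt_ls = embed_ps sqrt_ps"

definition u_ls :: laurent where
  "u_ls = (1 + t_ls\<^sup>2 - 2 * y_ls * t_ls - (1 - t_ls) * sqrt_ls) / (2 * (1 - y_ls) * t_ls)"

definition v_ls :: laurent where
  "v_ls = ((1 + t_ls)\<^sup>2 - 2 * y_ls * t_ls - (1 + t_ls) * sqrt_ls) / (2 * y_ls * t_ls)"


subsection \<open>Well-definedness of the square root, and \<open>u, v \<in> \<rat>[y][[t]]\<close>\<close>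

lemma ex1_sqrt_ps:
  "\<exists>!S :: rat poly fps. S\<^sup>2 = (1 + t_ps)\<^sup>2 - 4 * y_ps * t_ps \<and> fps_nth S 0 = 1"
proof -
  define D :: "rat poly fps" where "D = (1 + t_ps)\<^sup>2 - 4 * y_ps * t_ps"
  define B :: "rat poly fps" where "B = Abs_fps (\<lambda>n. [:fps_nth (fps_binomial (1/2)) n:])"
  define S where "S = B oo (D - 1)"
  have D0: "fps_nth (D - 1) 0 = 0"
    by (simp add: D_def t_ps_def power2_eq_square)
  have "fps_binomial (1/2) * fps_binomial (1/2) = (1 + fps_X :: rat fps)"
    by (simp add: fps_binomial_add_mult [symmetric] fps_binomial_1)
  hence *: "fps_nth (fps_binomial (1/2) * fps_binomial (1/2)) n = fps_nth (1 + fps_X :: rat fps) n"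
    for n by simp
  have sum_C: "(\<Sum>i\<in>A. [:f i:]) = [:\<Sum>i\<in>A. f i:]" for f :: "nat \<Rightarrow> rat" and A
    by (induction A rule: infinite_finite_induct) auto
  have "B * B = 1 + fps_X"
  proof (rule fps_ext)
    fix n
    have "fps_nth (B * B) n = [:fps_nth (fps_binomial (1/2) * fps_binomial (1/2) :: rat fps) n:]"
      by (simp add: B_def fps_mult_nth sum_C mult.commute)
    also have "\<dots> = fps_nth (1 + fps_X) n"
      unfolding * by (simp add: one_pCons)
    finally show "fps_nth (B * B) n = fps_nth (1 + fps_X) n" .
  qed
  hence S2: "S\<^sup>2 = D"
    using D0 by (simp add: S_def power2_eq_square fps_compose_mult_distrib [symmetric]
        fps_compose_add_distrib)
  have S0: "fps_nth S 0 = 1"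
    by (simp add: S_def fps_compose_nth B_def one_pCons)
  show ?thesis
    unfolding D_def [symmetric]
  proof (rule ex1I [of _ S])
    fix T :: "rat poly fps" assume T: "T\<^sup>2 = D \<and> fps_nth T 0 = 1"
    hence "T = S \<or> T = - S"
      using S2 by (metis power2_eq_iff)
    thus "T = S"
    proof
      assume "T = - S"
      hence "fps_nth T 0 = - fps_nth S 0" by simp
      with T S0 have "(1 :: rat poly) = - 1" by simp
      thus ?thesis by simp
    qed
  qed (use S2 S0 in simp)
qed

lemma sqrt_ps: "sqrt_ps\<^sup>2 = (1 + t_ps)\<^sup>2 - 4 * y_ps * t_ps" "fps_nth sqrt_ps 0 = 1"
  using theI' [OF ex1_sqrt_ps] unfolding sqrt_ps_def by blast+

lemma to_fract_sum: "to_fract (sum f A) = (\<Sum>x\<in>A. to_fract (f x))"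
  by (induction A rule: infinite_finite_induct) auto

lemma embed_ps_add: "embed_ps (f + g) = embed_ps f + embed_ps g"
  unfolding embed_ps_def fps_to_fls_plus [symmetric]
  by (rule arg_cong [of _ _ fps_to_fls]) (simp add: fps_eq_iff)

lemma embed_ps_diff: "embed_ps (f - g) = embed_ps f - embed_ps g"
  unfolding embed_ps_def fps_to_fls_minus [symmetric]
  by (rule arg_cong [of _ _ fps_to_fls]) (simp add: fps_eq_iff)

lemma embed_ps_mult: "embed_ps (f * g) = embed_ps f * embed_ps g"
  unfolding embed_ps_def fls_times_fps_to_fls [symmetric]
  by (simp add: fps_eq_iff fps_mult_nth to_fract_sum)

lemma embed_ps_1: "embed_ps 1 = 1"
proof -
  have "Abs_fps (\<lambda>n. to_fract (fps_nth 1 n :: rat poly)) = 1"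
    by (simp add: fps_eq_iff)
  thus ?thesis by (simp add: embed_ps_def)
qed

lemma embed_ps_2: "embed_ps 2 = 2"
  using embed_ps_add [of 1 1] by (simp add: embed_ps_1)

lemma inj_embed_ps: "inj embed_ps"
  by (rule injI) (simp add: embed_ps_def fps_eq_iff)

lemmas embed_ps_hom = embed_ps_add embed_ps_diff embed_ps_mult embed_ps_1 embed_ps_2 power2_eq_square

lemma quotient_in_range_embed_ps:
  assumes "\<And>n. c dvd fps_nth f n" "fps_nth f 0 = 0" "c \<noteq> 0"
  shows "embed_ps f / embed_ps (fps_const c * t_ps) \<in> range embed_ps"
proof -
  define g where "g = Abs_fps (\<lambda>n. fps_nth f (n + 1) div c)"
  have "f = fps_const c * t_ps * g"
  proof (rule fps_ext)
    fix n show "fps_nth f n = fps_nth (fps_const c * t_ps * g) n"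
      using assms(1,2) by (cases n) (simp_all add: g_def t_ps_def mult.assoc)
  qed
  moreover have "fps_const c * t_ps \<noteq> 0"
    using assms(3) by (simp add: t_ps_def)
  hence "embed_ps (fps_const c * t_ps) \<noteq> 0"
    using inj_embed_ps embed_ps_diff [of 0 0] by (metis diff_self injD)
  ultimately have "embed_ps f / embed_ps (fps_const c * t_ps) = embed_ps g"
    by (simp add: embed_ps_mult)
  thus ?thesis by simp
qed

definition eval_ps :: "rat \<Rightarrow> rat poly fps \<Rightarrow> rat fps" where
  "eval_ps a f = Abs_fps (\<lambda>n. poly (fps_nth f n) a)"

lemma eval_ps_hom:
  "eval_ps a (f + g) = eval_ps a f + eval_ps a g"
  "eval_ps a (f - g) = eval_ps a f - eval_ps a g"
  "eval_ps a (f * g) = eval_ps a f * eval_ps a g"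
  "eval_ps a 1 = 1"
  "eval_ps a t_ps = fps_X"
  "eval_ps a y_ps = fps_const a"
  by (auto simp: eval_ps_def fps_eq_iff fps_mult_nth poly_sum t_ps_def y_ps_def)

lemma eval_ps_numeral: "eval_ps a 2 = 2" "eval_ps a 4 = 4"
proof -
  show *: "eval_ps a 2 = 2"
    using eval_ps_hom(1) [of a 1 1] by (simp add: eval_ps_hom)
  show "eval_ps a 4 = 4"
    using eval_ps_hom(1) [of a 2 2] by (simp add: *)
qed

lemma eval_sqrt_ps:
  assumes "(1 + fps_X)\<^sup>2 - 4 * fps_const a * fps_X = F\<^sup>2" "fps_nth F 0 = 1"
  shows "eval_ps a sqrt_ps = F"
proof -
  have "(eval_ps a sqrt_ps)\<^sup>2 = eval_ps a (sqrt_ps\<^sup>2)"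
    by (simp add: eval_ps_hom power2_eq_square)
  also have "\<dots> = F\<^sup>2"
    unfolding sqrt_ps using assms(1) by (simp add: eval_ps_hom eval_ps_numeral power2_eq_square)
  finally have "eval_ps a sqrt_ps = F \<or> eval_ps a sqrt_ps = - F"
    by (simp add: power2_eq_iff)
  moreover have "fps_nth (eval_ps a sqrt_ps) 0 = 1"
    by (simp add: eval_ps_def sqrt_ps)
  hence "eval_ps a sqrt_ps \<noteq> - F"
    using assms(2) by auto
  ultimately show ?thesis by blast
qed

lemma dvd_nth_if_eval_ps_eq_0:
  assumes "eval_ps a f = 0"
  shows "[:-a, 1:] dvd fps_nth f n"
proof -
  have "fps_nth (eval_ps a f) n = 0" using assms by simp
  thus ?thesis by (simp add: eval_ps_def poly_eq_0_iff_dvd)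
qed

lemma u_ls_in_power_series: "u_ls \<in> range embed_ps"
proof -
  define f where "f = 1 + t_ps\<^sup>2 - 2 * y_ps * t_ps - (1 - t_ps) * sqrt_ps"
  have "eval_ps 1 sqrt_ps = 1 - fps_X"
    by (rule eval_sqrt_ps) (simp_all add: power2_eq_square algebra_simps)
  moreover have "eval_ps 1 f = 1 + fps_X\<^sup>2 - 2 * fps_X - (1 - fps_X) * eval_ps 1 sqrt_ps"
    by (simp add: f_def eval_ps_hom eval_ps_numeral power2_eq_square)
  ultimately have "eval_ps 1 f = 0"
    by (simp only:) (simp add: power2_eq_square algebra_simps)
  hence *: "[:-1, 1:] dvd fps_nth f n" for n
    by (rule dvd_nth_if_eval_ps_eq_0)
  have c: "[:2, -2:] = smult (-2) ([:-1, 1:] :: rat poly)" by simp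
  have "[:2, -2:] dvd fps_nth f n" for n
    unfolding c by (rule smult_dvd [OF *]) simp
  moreover have "fps_nth f 0 = 0"
    by (simp add: f_def t_ps_def y_ps_def sqrt_ps)
  ultimately have "embed_ps f / embed_ps (fps_const [:2, -2:] * t_ps) \<in> range embed_ps"
    by (rule quotient_in_range_embed_ps) simp
  moreover have "fps_const [:2, -2:] = 2 * (1 - y_ps)"
    by (simp add: y_ps_def fps_eq_iff numeral_fps_const one_pCons numeral_poly)
  ultimately show ?thesis
    by (simp add: u_ls_def f_def y_ls_def t_ls_def sqrt_ls_def embed_ps_hom)
qed

lemma v_ls_in_power_series: "v_ls \<in> range embed_ps"
proof -
  define f where "f = (1 + t_ps)\<^sup>2 - 2 * y_ps * t_ps - (1 + t_ps) * sqrt_ps"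
  have "eval_ps 0 sqrt_ps = 1 + fps_X"
    by (rule eval_sqrt_ps) simp_all
  hence "eval_ps 0 f = 0"
    by (simp add: f_def eval_ps_hom eval_ps_numeral power2_eq_square algebra_simps)
  hence *: "[:-0, 1:] dvd fps_nth f n" for n
    by (rule dvd_nth_if_eval_ps_eq_0)
  have c: "[:0, 2:] = smult 2 ([:-0, 1:] :: rat poly)" by simp
  have "[:0, 2:] dvd fps_nth f n" for n
    unfolding c by (rule smult_dvd [OF *]) simp
  moreover have "fps_nth f 0 = 0"
    by (simp add: f_def t_ps_def y_ps_def sqrt_ps power2_eq_square)
  ultimately have "embed_ps f / embed_ps (fps_const [:0, 2:] * t_ps) \<in> range embed_ps"
    by (rule quotient_in_range_embed_ps) simp
  moreover have "fps_const [:0, 2:] = 2 * y_ps"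
    by (simp add: y_ps_def fps_eq_iff numeral_fps_const numeral_poly)
  ultimately show ?thesis
    by (simp add: v_ls_def f_def y_ls_def t_ls_def sqrt_ls_def embed_ps_hom)
qed

end

theory Submission
  imports Defs
begin

text \<open>Inserting \<open>n + 1\<close> into a permutation of \<open>[n]\<close> with \<open>p\<close> peaks and \<open>d\<close> descents changes \<open>(p, d)\<close>
  in a way that depends only on whether the chosen gap is at an end, next to a peak, at another
  descent or at another ascent. The resulting recurrence preserves the shape
  \<open>P\<^sub>n(y, t) = (\<Sum>p. \<gamma>\<^sub>n\<^sub>,\<^sub>p (y t)\<^bsup>p+1\<^esup> (1 + t)\<^bsup>n-1-2p\<^esup>)\<close>, and \<open>A\<^sub>n(t) = P\<^sub>n(1, t)\<close>. Since every summand has weight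
  \<open>2 (p + 1) + (n - 1 - 2 p) = n + 1\<close>, the conditions \<open>y t = r\<^sup>2 v\<close> and \<open>1 + t = r (1 + v)\<close> imply
  \<open>P\<^sub>n(y, t) = r\<^bsup>n+1\<^esup> A\<^sub>n(v)\<close>; both identities are instances.\<close>

section \<open>Descent sets and peak sets\<close>

definition des_set :: "nat \<Rightarrow> (nat \<Rightarrow> nat) \<Rightarrow> nat set" where
  "des_set n \<pi> = {i. 1 \<le> i \<and> i \<le> n - 1 \<and> \<pi> i > \<pi> (i + 1)}"

definition pk_set :: "nat \<Rightarrow> (nat \<Rightarrow> nat) \<Rightarrow> nat set" where
  "pk_set n \<pi> = {i. 2 \<le> i \<and> i \<le> n - 1 \<and> \<pi> (i - 1) < \<pi> i \<and> \<pi> i > \<pi> (i + 1)}"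

lemma des_eq_card: "des n \<pi> = card (des_set n \<pi>)"
  by (simp add: des_def des_set_def)

lemma pk_eq_card: "pk n \<pi> = card (pk_set n \<pi>)"
  by (simp add: pk_def pk_set_def)

lemma des_set_subset: "des_set n \<pi> \<subseteq> {1..n - 1}"
  by (auto simp: des_set_def)

lemma pk_set_subset: "pk_set n \<pi> \<subseteq> des_set n \<pi>"
  by (auto simp: pk_set_def des_set_def)

lemma finite_des_set [simp]: "finite (des_set n \<pi>)"
  by (rule finite_subset [OF des_set_subset]) simp

lemma finite_pk_set [simp]: "finite (pk_set n \<pi>)"
  by (rule finite_subset [OF pk_set_subset]) simp

section \<open>Inserting a new largest letter\<close>

text \<open>Composing a permutation of \<open>[n]\<close> with \<open>insert_cycle n k\<close> inserts the letter \<open>n + 1\<close> at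
  position \<open>k\<close> of its one-line notation.\<close>

definition insert_cycle :: "nat \<Rightarrow> nat \<Rightarrow> nat \<Rightarrow> nat" where
  "insert_cycle n k i =
     (if i < k then i else if i = k then Suc n else if i \<le> Suc n then i - 1 else i)"

lemma insert_cycle_permutes:
  assumes "k \<in> {1..Suc n}"
  shows "insert_cycle n k permutes {1..Suc n}"
proof (rule bij_imp_permutes)
  have "inj_on (insert_cycle n k) {1..Suc n}"
    by (rule inj_onI) (use assms in \<open>auto simp: insert_cycle_def split: if_splits\<close>)
  moreover have "insert_cycle n k ` {1..Suc n} \<subseteq> {1..Suc n}"
    using assms by (auto simp: insert_cycle_def)
  ultimately show "bij_betw (insert_cycle n k) {1..Suc n} {1..Suc n}"
    by (simp add: bij_betw_def endo_inj_surj)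
qed (use assms in \<open>auto simp: insert_cycle_def\<close>)

text \<open>The position of the letter \<open>Suc n\<close> recovers \<open>k\<close>, and
  cancelling the bijection \<open>insert_cycle n k\<close> then recovers the permutation.
  Surjectivity follows by counting, since n! (n + 1) = (n + 1)!.\<close>

lemma bij_betw_insert_max:
  "bij_betw (\<lambda>(\<pi>, k). \<pi> \<circ> insert_cycle n k)
     ({\<pi>. \<pi> permutes {1..n}} \<times> {1..Suc n}) {\<sigma>. \<sigma> permutes {1..Suc n}}"
    (is "bij_betw ?h ?A ?B")
proof -
  have fix_max: "\<pi> (Suc n) = Suc n" if "\<pi> permutes {1..n}" for \<pi>
    using that by (simp add: permutes_not_in)
  have up: "\<pi> permutes {1..Suc n}" if "\<pi> permutes {1..n}" for \<pi>
    using that by (rule permutes_subset) auto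
  have inj: "inj_on ?h ?A"
  proof (rule inj_onI, clarify, rule conjI)
    fix \<pi> \<pi>' k k'
    assume \<pi>: "\<pi> permutes {1..n}" "\<pi>' permutes {1..n}" and k: "k \<in> {1..Suc n}" "k' \<in> {1..Suc n}"
      and eq: "\<pi> \<circ> insert_cycle n k = \<pi>' \<circ> insert_cycle n k'"
    have "(\<pi> \<circ> insert_cycle n k) k = Suc n" "(\<pi>' \<circ> insert_cycle n k') k' = Suc n"
      using \<pi> by (simp_all add: insert_cycle_def fix_max)
    moreover have "inj (\<pi> \<circ> insert_cycle n k)"
      by (rule permutes_inj [OF permutes_compose [OF insert_cycle_permutes [OF k(1)] up [OF \<pi>(1)]]])
    ultimately have "k = k'"
      using eq by (metis injD)
    thus "k = k'" .
    show "\<pi> = \<pi>'"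
    proof
      fix x
      obtain z where "x = insert_cycle n k z"
        using permutes_surj [OF insert_cycle_permutes [OF k(1)]] by (metis surjD)
      thus "\<pi> x = \<pi>' x"
        using fun_cong [OF eq, of z] \<open>k = k'\<close> by simp
    qed
  qed
  have sub: "?h ` ?A \<subseteq> ?B"
    by (clarsimp simp del: atLeastAtMost_iff simp flip: One_nat_def)
       (rule permutes_compose [OF insert_cycle_permutes up])
  have "card ?B = fact (Suc n)"
    by (rule card_permutations) auto
  moreover have "card {\<pi>. \<pi> permutes {1..n}} = fact n"
    by (rule card_permutations) auto
  hence "card ?A = fact (Suc n)"
    by (simp add: card_cartesian_product algebra_simps)
  ultimately have "?h ` ?A = ?B"
    by (intro card_subset_eq finite_permutations sub) (simp_all only: card_image [OF inj] finite_atLeastAtMost)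
  with inj show ?thesis
    by (simp add: bij_betw_def)
qed

context
  fixes n k :: nat and \<pi> \<sigma> :: "nat \<Rightarrow> nat"
  assumes n: "n \<ge> 1" and \<pi>: "\<pi> permutes {1..n}" and k: "1 \<le> k" "k \<le> Suc n"
    and \<sigma>: "\<sigma> = \<pi> \<circ> insert_cycle n k"
begin

lemma insert_max_simps:
  "\<And>i. i < k \<Longrightarrow> \<sigma> i = \<pi> i" "\<sigma> k = Suc n" "\<And>i. k \<le> i \<Longrightarrow> i \<le> n \<Longrightarrow> \<sigma> (Suc i) = \<pi> i"
  using \<pi> by (auto simp: \<sigma> insert_cycle_def permutes_not_in)

lemma permutes_less_Suc: "1 \<le> i \<Longrightarrow> i \<le> n \<Longrightarrow> \<pi> i < Suc n"
  using permutes_in_image [OF \<pi>, of i] by auto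

text \<open>The new maximum turns the step into it into an ascent, so a descent at
  \<open>k - 1\<close> is lost. The step out of it is a descent unless it stands last, and later
  descents move right by one.\<close>

lemma des_set_insert_max:
  "des_set (Suc n) \<sigma> =
     {i \<in> des_set n \<pi>. Suc i < k} \<union> {i. i = k \<and> k \<le> n} \<union> Suc ` {i \<in> des_set n \<pi>. k \<le> i}"
proof (rule set_eqI)
  fix i
  consider "Suc i < k" | "Suc i = k" | "i = k" | j where "i = Suc j" "k \<le> j"
    by (metis Suc_leI le_less_Suc_eq less_imp_Suc_add linorder_neqE_nat le_add1 not_less_eq add_Suc_right)
  thus "i \<in> des_set (Suc n) \<sigma> \<longleftrightarrow> i \<in> {i \<in> des_set n \<pi>. Suc i < k} \<union> {i. i = k \<and> k \<le> n} \<union>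
          Suc ` {i \<in> des_set n \<pi>. k \<le> i}"
  proof cases
    case 1
    thus ?thesis using k by (auto simp: des_set_def insert_max_simps)
  next
    case 2
    hence "\<sigma> i = \<pi> i" "\<sigma> (Suc i) = Suc n"
      using insert_max_simps by auto
    moreover have "1 \<le> i \<Longrightarrow> \<pi> i < Suc n"
      using 2 k by (intro permutes_less_Suc) auto
    ultimately show ?thesis using 2 by (auto simp: des_set_def)
  next
    case 3
    have "i \<le> n \<Longrightarrow> \<sigma> (Suc i) = \<pi> i" "\<sigma> i = Suc n"
      using 3 insert_max_simps by auto
    moreover have "i \<le> n \<Longrightarrow> \<pi> i < Suc n"
      using 3 k by (intro permutes_less_Suc) auto
    ultimately show ?thesis using 3 k by (auto simp: des_set_def)
  next
    case 4
    thus ?thesis using k by (auto simp: des_set_def insert_max_simps)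
  qed
qed

text \<open>The old letters at positions \<open>k - 1\<close> and \<open>k\<close> become neighbours
  of the new maximum, so neither can stay a peak. The maximum is itself a peak unless it stands at
  an end.\<close>

lemma pk_set_insert_max:
  "pk_set (Suc n) \<sigma> =
     {i \<in> pk_set n \<pi>. Suc i < k} \<union> {i. i = k \<and> 2 \<le> k \<and> k \<le> n} \<union> Suc ` {i \<in> pk_set n \<pi>. k < i}"
proof (rule set_eqI)
  fix i
  consider "Suc i < k" | "Suc i = k" | "i = k" | "i = Suc k" | j where "i = Suc j" "k < j"
    by (metis Suc_leI le_less_Suc_eq less_imp_Suc_add linorder_neqE_nat le_add1 not_less_eq add_Suc_right)
  thus "i \<in> pk_set (Suc n) \<sigma> \<longleftrightarrow> i \<in> {i \<in> pk_set n \<pi>. Suc i < k} \<union>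
          {i. i = k \<and> 2 \<le> k \<and> k \<le> n} \<union> Suc ` {i \<in> pk_set n \<pi>. k < i}"
  proof cases
    case 1
    thus ?thesis using k by (auto simp: pk_set_def insert_max_simps)
  next
    case 2
    hence "\<sigma> i = \<pi> i" "\<sigma> (Suc i) = Suc n"
      using insert_max_simps by auto
    moreover have "1 \<le> i \<Longrightarrow> \<pi> i < Suc n"
      using 2 k by (intro permutes_less_Suc) auto
    ultimately show ?thesis using 2 by (auto simp: pk_set_def)
  next
    case 3
    have "i \<le> n \<Longrightarrow> \<sigma> (Suc i) = \<pi> i" "\<sigma> i = Suc n" "2 \<le> i \<Longrightarrow> \<sigma> (i - 1) = \<pi> (i - 1)"
      using 3 insert_max_simps by auto
    moreover have "i \<le> n \<Longrightarrow> \<pi> i < Suc n" "2 \<le> i \<Longrightarrow> \<pi> (i - 1) < Suc n"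
      using 3 k by (intro permutes_less_Suc; auto)+
    ultimately show ?thesis using 3 k by (auto simp: pk_set_def)
  next
    case 4
    have "k \<le> n \<Longrightarrow> \<sigma> (Suc k) = \<pi> k" "\<sigma> k = Suc n"
      using insert_max_simps by auto
    moreover have "k \<le> n \<Longrightarrow> \<pi> k < Suc n"
      using k by (intro permutes_less_Suc) auto
    ultimately show ?thesis using 4 k by (auto simp: pk_set_def)
  next
    case 5
    then obtain l where "j = Suc l" "k \<le> l"
      by (cases j) auto
    with 5 show ?thesis using k by (auto simp: pk_set_def insert_max_simps)
  qed
qed

text \<open>The additive form avoids truncated subtraction: the intersection counts the descent that
  is lost. It is empty for \<open>k = 1\<close>, since 0 is never a descent.\<close>

lemma des_insert_max:
  "des (Suc n) \<sigma> + card (des_set n \<pi> \<inter> {k - 1}) = des n \<pi> + of_bool (k \<le> n)"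
proof -
  let ?D = "des_set n \<pi>"
  have "des (Suc n) \<sigma> = card {i \<in> ?D. Suc i < k} + card {i. i = k \<and> k \<le> n} +
          card (Suc ` {i \<in> ?D. k \<le> i})"
    unfolding des_eq_card des_set_insert_max
    by (subst card_Un_disjoint; (subst card_Un_disjoint)?) auto
  moreover have "card {i. i = k \<and> k \<le> n} = of_bool (k \<le> n)"
    by (cases "k \<le> n") auto
  moreover have "card (Suc ` {i \<in> ?D. k \<le> i}) = card {i \<in> ?D. k \<le> i}"
    by (rule card_image) auto
  moreover have "?D = {i \<in> ?D. Suc i < k} \<union> {i \<in> ?D. k \<le> i} \<union> (?D \<inter> {k - 1})"
    using k by auto
  hence "card ?D = card {i \<in> ?D. Suc i < k} + card {i \<in> ?D. k \<le> i} + card (?D \<inter> {k - 1})"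
    by (rule ssubst [where P = "\<lambda>A. card A = _"])
       (use k in \<open>subst card_Un_disjoint; (subst card_Un_disjoint)?; auto\<close>)
  ultimately show ?thesis
    by (simp add: des_eq_card)
qed

lemma pk_insert_max:
  "pk (Suc n) \<sigma> + card (pk_set n \<pi> \<inter> {k - 1, k}) = pk n \<pi> + of_bool (2 \<le> k \<and> k \<le> n)"
proof -
  let ?P = "pk_set n \<pi>"
  have "pk (Suc n) \<sigma> = card {i \<in> ?P. Suc i < k} + card {i. i = k \<and> 2 \<le> k \<and> k \<le> n} +
          card (Suc ` {i \<in> ?P. k < i})"
    unfolding pk_eq_card pk_set_insert_max
    by (subst card_Un_disjoint; (subst card_Un_disjoint)?) auto
  moreover have "card {i. i = k \<and> 2 \<le> k \<and> k \<le> n} = of_bool (2 \<le> k \<and> k \<le> n)"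
    by (cases "2 \<le> k \<and> k \<le> n") auto
  moreover have "card (Suc ` {i \<in> ?P. k < i}) = card {i \<in> ?P. k < i}"
    by (rule card_image) auto
  moreover have "?P = {i \<in> ?P. Suc i < k} \<union> {i \<in> ?P. k < i} \<union> (?P \<inter> {k - 1, k})"
    using k by auto
  hence "card ?P = card {i \<in> ?P. Suc i < k} + card {i \<in> ?P. k < i} + card (?P \<inter> {k - 1, k})"
    by (rule ssubst [where P = "\<lambda>A. card A = _"])
       (use k in \<open>subst card_Un_disjoint; (subst card_Un_disjoint)?; auto\<close>)
  ultimately show ?thesis
    by (simp add: pk_eq_card)
qed

end

section \<open>The recurrence obtained by classifying gaps\<close>

text \<open>With p peaks and d descents, the front gap adds a descent and the last gap changes
  nothing. Of the interior gaps, the p just after a peak change nothing, the p just before a peak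
  add a descent, the other d - p descents add a peak, and the other n - 1 - d - p ascents add
  both.\<close>

lemma sum_insert_max:
  fixes f :: "nat \<Rightarrow> nat \<Rightarrow> 'a::comm_semiring_1"
  assumes n: "n \<ge> 1" and \<pi>: "\<pi> permutes {1..n}"
  shows "(\<Sum>k\<in>{1..Suc n}. f (pk (Suc n) (\<pi> \<circ> insert_cycle n k)) (des (Suc n) (\<pi> \<circ> insert_cycle n k))) =
     of_nat (Suc (pk n \<pi>)) * (f (pk n \<pi>) (des n \<pi>) + f (pk n \<pi>) (Suc (des n \<pi>))) +
     of_nat (des n \<pi> - pk n \<pi>) * f (Suc (pk n \<pi>)) (des n \<pi>) +
     of_nat (n - 1 - des n \<pi> - pk n \<pi>) * f (Suc (pk n \<pi>)) (Suc (des n \<pi>))"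
proof -
  define p d where "p = pk n \<pi>" and "d = des n \<pi>"
  define P D where "P = pk_set n \<pi>" and "D = des_set n \<pi>"
  \<comment> \<open>\<open>Q\<close> marks the gaps just before the peaks. Peaks lie at positions at
    least 2, so the subtraction is exact and \<open>Q\<close> is as large as
    \<open>P\<close>.\<close>
  define Q where "Q = (\<lambda>i. i - 1) ` P"
  define F where "F k = f (pk (Suc n) (\<pi> \<circ> insert_cycle n k)) (des (Suc n) (\<pi> \<circ> insert_cycle n k))" for k
  have fin [simp]: "finite P" "finite D" "finite Q"
    by (auto simp: P_def D_def Q_def)
  have sub: "P \<subseteq> D" "D \<subseteq> {1..n-1}"
    unfolding P_def D_def by (rule pk_set_subset, rule des_set_subset)
  have P2: "i \<ge> 2" if "i \<in> P" for i
    using that by (auto simp: P_def pk_set_def)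
  have Qiff: "i \<in> Q \<longleftrightarrow> Suc i \<in> P" for i
  proof
    assume "i \<in> Q"
    then obtain j where "j \<in> P" "i = j - 1" by (auto simp: Q_def)
    with P2 [of j] show "Suc i \<in> P" by simp
  next
    assume "Suc i \<in> P"
    thus "i \<in> Q" unfolding Q_def by (rule rev_image_eqI) simp
  qed
  \<comment> \<open>The step into a peak is an ascent. Hence no two peaks are adjacent, and
    \<open>Q\<close> is disjoint from \<open>D\<close>.\<close>
  have PD: "i \<notin> D" if "Suc i \<in> P" for i
    using that by (auto simp: P_def D_def pk_set_def des_set_def)
  have Qsub: "Q \<subseteq> {1..n - 1} - D"
    using PD sub P2 by (fastforce simp: Qiff)
  have cards: "card P = p" "card D = d" "card Q = p"
    by (simp_all add: p_def d_def P_def D_def pk_eq_card des_eq_card Q_def)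
       (rule card_image, use P2 P_def in \<open>force simp: inj_on_def\<close>)
  note des = des_insert_max [OF n \<pi> _ _ refl, folded D_def d_def]
  note pk = pk_insert_max [OF n \<pi> _ _ refl, folded P_def p_def]
  have first: "F 1 = f p (Suc d)"
  proof -
    have "D \<inter> {0} = {}" "P \<inter> {0, 1} = {}"
      using sub P2 by fastforce+
    thus ?thesis using des [of 1] pk [of 1] n by (simp add: F_def)
  qed
  have last: "F (Suc n) = f p d"
  proof -
    have "D \<inter> {n} = {}" "P \<inter> {n, Suc n} = {}"
      using sub n by fastforce+
    thus ?thesis using des [of "Suc n"] pk [of "Suc n"] by (simp add: F_def)
  qed
  have F_P: "F (Suc i) = f p d" if "i \<in> P" for i
  proof -
    have "i \<in> {1..n - 1}" using that sub by blast
    hence i: "1 \<le> i" "Suc i \<le> n" by auto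
    have "D \<inter> {i} = {i}" "P \<inter> {i, Suc i} = {i}" using that sub PD by auto
    hence "des (Suc n) (\<pi> \<circ> insert_cycle n (Suc i)) = d" "pk (Suc n) (\<pi> \<circ> insert_cycle n (Suc i)) = p"
      using des [of "Suc i"] pk [of "Suc i"] i by simp_all
    thus ?thesis by (simp add: F_def)
  qed
  have F_Q: "F (Suc i) = f p (Suc d)" if "i \<in> Q" for i
  proof -
    have "i \<in> {1..n - 1}" using that sub Qsub by blast
    hence i: "1 \<le> i" "Suc i \<le> n" by auto
    have "D \<inter> {i} = {}" "P \<inter> {i, Suc i} = {Suc i}" using that sub PD Qsub Qiff by auto
    hence "des (Suc n) (\<pi> \<circ> insert_cycle n (Suc i)) = Suc d" "pk (Suc n) (\<pi> \<circ> insert_cycle n (Suc i)) = p"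
      using des [of "Suc i"] pk [of "Suc i"] i by simp_all
    thus ?thesis by (simp add: F_def)
  qed
  have F_DP: "F (Suc i) = f (Suc p) d" if "i \<in> D - P" for i
  proof -
    have "i \<in> {1..n - 1}" using that sub Qsub by blast
    hence i: "1 \<le> i" "Suc i \<le> n" by auto
    have "D \<inter> {i} = {i}" "P \<inter> {i, Suc i} = {}" using that sub PD Qsub Qiff by auto
    hence "des (Suc n) (\<pi> \<circ> insert_cycle n (Suc i)) = d" "pk (Suc n) (\<pi> \<circ> insert_cycle n (Suc i)) = Suc p"
      using des [of "Suc i"] pk [of "Suc i"] i by simp_all
    thus ?thesis by (simp add: F_def)
  qed
  have F_rest: "F (Suc i) = f (Suc p) (Suc d)" if "i \<in> {1..n-1} - D - Q" for i
  proof -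
    have "i \<in> {1..n - 1}" using that sub Qsub by blast
    hence i: "1 \<le> i" "Suc i \<le> n" by auto
    have "D \<inter> {i} = {}" "P \<inter> {i, Suc i} = {}" using that sub PD Qsub Qiff by auto
    hence "des (Suc n) (\<pi> \<circ> insert_cycle n (Suc i)) = Suc d" "pk (Suc n) (\<pi> \<circ> insert_cycle n (Suc i)) = Suc p"
      using des [of "Suc i"] pk [of "Suc i"] i by simp_all
    thus ?thesis by (simp add: F_def)
  qed
  have "(\<Sum>k\<in>{1..Suc n}. F k) = F 1 + (\<Sum>k\<in>Suc ` {1..n - 1}. F k) + F (Suc n)"
  proof -
    have "{1..Suc n} = insert 1 (insert (Suc n) (Suc ` {1..n - 1}))"
      using n by (auto simp: image_iff Bex_def)
    thus ?thesis using n by (simp add: add_ac image_iff)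
  qed
  also have "(\<Sum>k\<in>Suc ` {1..n - 1}. F k) = (\<Sum>i\<in>{1..n - 1}. F (Suc i))"
    by (subst sum.reindex) (simp_all only: inj_Suc comp_def)
  also have "{1..n - 1} = P \<union> (D - P) \<union> Q \<union> ({1..n-1} - D - Q)"
    using sub Qsub by auto
  also have "(\<Sum>i\<in>\<dots>. F (Suc i)) = (\<Sum>i\<in>P. F (Suc i)) + (\<Sum>i\<in>D - P. F (Suc i)) +
      (\<Sum>i\<in>Q. F (Suc i)) + (\<Sum>i\<in>{1..n-1} - D - Q. F (Suc i))"
    using sub Qsub by (subst sum.union_disjoint; (subst sum.union_disjoint)?; (subst sum.union_disjoint)?) auto
  also have "(\<Sum>i\<in>P. F (Suc i)) = of_nat p * f p d"
    by (simp add: F_P cards)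
  also have "(\<Sum>i\<in>Q. F (Suc i)) = of_nat p * f p (Suc d)"
    by (simp add: F_Q cards)
  also have "(\<Sum>i\<in>D - P. F (Suc i)) = of_nat (d - p) * f (Suc p) d"
    using sub by (simp add: F_DP cards card_Diff_subset)
  also have "(\<Sum>i\<in>{1..n-1} - D - Q. F (Suc i)) = of_nat (n - 1 - d - p) * f (Suc p) (Suc d)"
    using sub Qsub by (simp add: F_rest cards card_Diff_subset)
  also note first
  also note last
  finally show ?thesis
    unfolding F_def p_def [symmetric] d_def [symmetric]
    by (rule trans) (simp add: algebra_simps)
qed

section \<open>The gamma expansion\<close>

text \<open>\<open>gamma_coeff m\<close> belongs to the permutations of \<open>[m + 1]\<close>. It vanishes at \<open>p\<close> unless \<open>2 * p \<le> m\<close>,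
  so that the truncation in \<open>m - 2 * p\<close> does no harm.\<close>

fun gamma_coeff :: "nat \<Rightarrow> nat \<Rightarrow> nat" where
  "gamma_coeff 0 p = of_bool (p = 0)"
| "gamma_coeff (Suc m) 0 = gamma_coeff m 0"
| "gamma_coeff (Suc m) (Suc p) =
     (p + 2) * gamma_coeff m (Suc p) + 2 * (m - 2 * p) * gamma_coeff m p"

text \<open>For \<open>m \<le> 2 * p\<close> the truncated factor \<open>m - 2 * p\<close> is 0, so
  the recurrence feeds nothing into column \<open>Suc p\<close> before row
  \<open>2 * p + 2\<close>.\<close>

lemma gamma_coeff_eq_0: "m < 2 * p \<Longrightarrow> gamma_coeff m p = 0"
  by (induction m p rule: gamma_coeff.induct) auto

text \<open>For the weight \<open>f p d = y ^ p * t ^ d\<close> this is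
  \<open>(y * t) ^ p * (1 + t) ^ m\<close>. An arbitrary \<open>f\<close> expresses the expansion
  coefficient by coefficient.\<close>

definition binomial_sum :: "nat \<Rightarrow> nat \<Rightarrow> (nat \<Rightarrow> nat \<Rightarrow> 'a) \<Rightarrow> 'a::comm_semiring_1" where
  "binomial_sum m p f = (\<Sum>j\<le>m. of_nat (m choose j) * f p (p + j))"

text \<open>Pascal's rule, the counterpart of splitting one factor \<open>1 + t\<close> off a
  power.\<close>

lemma binomial_sum_Suc:
  "binomial_sum (Suc m) p f = binomial_sum m p f + binomial_sum m p (\<lambda>p d. f p (Suc d))"
proof -
  have "binomial_sum (Suc m) p f = f p p + (\<Sum>j\<le>m. of_nat (Suc m choose Suc j) * f p (Suc (p + j)))"
    unfolding binomial_sum_def by (subst sum.atMost_Suc_shift) simp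
  also have "\<dots> = f p p + (\<Sum>j\<le>m. of_nat (m choose Suc j) * f p (Suc (p + j))) +
      (\<Sum>j\<le>m. of_nat (m choose j) * f p (Suc (p + j)))"
    by (simp add: algebra_simps sum.distrib)
  also have "f p p + (\<Sum>j\<le>m. of_nat (m choose Suc j) * f p (Suc (p + j))) =
      (\<Sum>j\<le>Suc m. of_nat (m choose j) * f p (p + j))"
    by (subst sum.atMost_Suc_shift) simp
  also have "\<dots> = (\<Sum>j\<le>m. of_nat (m choose j) * f p (p + j))"
    by (simp add: binomial_eq_0)
  finally show ?thesis by (simp add: binomial_sum_def)
qed

text \<open>Both \<open>j * (m choose j)\<close> and \<open>(m - j) * (m choose j)\<close> absorb
  into \<open>m\<close> times a binomial coefficient of \<open>m - 1\<close>. After an index shift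
  the two halves coincide, whence the factor 2.\<close>

lemma binomial_sum_absorb:
  fixes f :: "nat \<Rightarrow> nat \<Rightarrow> 'a::comm_semiring_1"
  shows "(\<Sum>j\<le>m. of_nat (m choose j) * (of_nat j * f (Suc p) (p + j) +
            of_nat (m - j) * f (Suc p) (Suc (p + j)))) =
         of_nat (2 * m) * binomial_sum (m - 1) (Suc p) f"
proof (cases m)
  case (Suc l)
  have 1: "(\<Sum>j\<le>m. of_nat (m choose j) * (of_nat j * f (Suc p) (p + j))) =
      of_nat m * binomial_sum l (Suc p) f"
  proof -
    have "of_nat (m choose Suc j) * (of_nat (Suc j) * x) = of_nat m * (of_nat (l choose j) * x)"
      for j and x :: 'a
      unfolding Suc mult.assoc [symmetric] of_nat_mult [symmetric] Suc_times_binomial_eq ..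
    thus ?thesis
      unfolding Suc by (subst sum.atMost_Suc_shift) (simp add: binomial_sum_def sum_distrib_left del: of_nat_Suc binomial_Suc_Suc)
  qed
  have 2: "(\<Sum>j\<le>m. of_nat (m choose j) * (of_nat (m - j) * f (Suc p) (Suc (p + j)))) =
      of_nat m * binomial_sum l (Suc p) f"
  proof -
    have "of_nat (m choose j) * (of_nat (m - j) * x) = of_nat m * (of_nat (l choose j) * x)"
      if "j \<le> l" for j and x :: 'a
      using binomial_absorb_comp [of m j] unfolding mult.assoc [symmetric] of_nat_mult [symmetric]
      by (simp add: Suc mult.commute del: binomial_Suc_Suc)
    thus ?thesis
      unfolding Suc by (simp add: binomial_sum_def sum_distrib_left del: of_nat_Suc binomial_Suc_Suc)
  qed
  show ?thesis
    unfolding distrib_left sum.distrib 1 2 by (simp only: Suc mult_2 of_nat_add distrib_right diff_Suc_1)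
qed simp

text \<open>The weight \<open>f\<close> is arbitrary because an insertion step replaces it by
  another weight, to which the induction hypothesis is applied.\<close>

lemma sum_pk_des_gamma:
  fixes f :: "nat \<Rightarrow> nat \<Rightarrow> 'a::comm_semiring_1"
  shows "(\<Sum>\<pi> | \<pi> permutes {1..Suc m}. f (pk (Suc m) \<pi>) (des (Suc m) \<pi>)) =
    (\<Sum>p\<le>m. of_nat (gamma_coeff m p) * binomial_sum (m - 2 * p) p f)"
proof (induction m arbitrary: f)
  case 0
  have "{\<pi>. \<pi> permutes {1..Suc 0}} = {id}"
    by (auto simp: permutes_sing)
  thus ?case
    by (simp add: binomial_sum_def pk_def des_def)
next
  case (Suc m)
  \<comment> \<open>By \<open>sum_insert_max\<close>, \<open>g p d\<close> is the total weight of
    all insertions into one permutation of \<open>[m + 1]\<close> with \<open>p\<close> peaks and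
    \<open>d\<close> descents.\<close>
  define g where "g p d = of_nat (Suc p) * (f p d + f p (Suc d)) + of_nat (d - p) * f (Suc p) d +
    of_nat (m - d - p) * f (Suc p) (Suc d)" for p d
  have "(\<Sum>\<sigma> | \<sigma> permutes {1..Suc (Suc m)}. f (pk (Suc (Suc m)) \<sigma>) (des (Suc (Suc m)) \<sigma>)) =
     (\<Sum>(\<pi>, k)\<in>{\<pi>. \<pi> permutes {1..Suc m}} \<times> {1..Suc (Suc m)}.
        f (pk (Suc (Suc m)) (\<pi> \<circ> insert_cycle (Suc m) k)) (des (Suc (Suc m)) (\<pi> \<circ> insert_cycle (Suc m) k)))"
    using sum.reindex_bij_betw [OF bij_betw_insert_max [of "Suc m"],
        of "\<lambda>\<sigma>. f (pk (Suc (Suc m)) \<sigma>) (des (Suc (Suc m)) \<sigma>)"]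
    by (simp add: case_prod_unfold)
  also have "\<dots> = (\<Sum>\<pi> | \<pi> permutes {1..Suc m}. g (pk (Suc m) \<pi>) (des (Suc m) \<pi>))"
    unfolding sum.cartesian_product [symmetric] g_def
    by (intro sum.cong refl, subst sum_insert_max) simp_all
  also have "\<dots> = (\<Sum>p\<le>m. of_nat (gamma_coeff m p) * binomial_sum (m - 2 * p) p g)"
    by (rule Suc.IH)
  also have "\<dots> = (\<Sum>p\<le>m. of_nat (Suc p * gamma_coeff m p) * binomial_sum (Suc m - 2 * p) p f +
      of_nat (2 * (m - 2 * p) * gamma_coeff m p) * binomial_sum (Suc m - 2 * Suc p) (Suc p) f)"
  proof (intro sum.cong refl)
    fix p
    show "of_nat (gamma_coeff m p) * binomial_sum (m - 2 * p) p g =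
      of_nat (Suc p * gamma_coeff m p) * binomial_sum (Suc m - 2 * p) p f +
      of_nat (2 * (m - 2 * p) * gamma_coeff m p) * binomial_sum (Suc m - 2 * Suc p) (Suc p) f"
    proof (cases "2 * p \<le> m")
      case True
      \<comment> \<open>With \<open>d = p + j\<close>, the multiplicities \<open>d - p\<close> and
        \<open>m - d - p\<close> in \<open>g\<close> become \<open>j\<close> and
        \<open>l - j\<close>, as \<open>binomial_sum_absorb\<close> requires.\<close>
      define l where "l = m - 2 * p"
      have "binomial_sum l p g =
          of_nat (Suc p) * (binomial_sum l p f + binomial_sum l p (\<lambda>p d. f p (Suc d))) +
          (\<Sum>j\<le>l. of_nat (l choose j) * (of_nat j * f (Suc p) (p + j) +
            of_nat (l - j) * f (Suc p) (Suc (p + j))))"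
        unfolding binomial_sum_def sum.distrib [symmetric] sum_distrib_left
      proof (intro sum.cong refl)
        fix j
        have "m - (p + j) - p = l - j" by (simp add: l_def)
        thus "of_nat (l choose j) * g p (p + j) = of_nat (Suc p) * (of_nat (l choose j) * f p (p + j) +
            of_nat (l choose j) * f p (Suc (p + j))) + of_nat (l choose j) * (of_nat j * f (Suc p) (p + j) +
            of_nat (l - j) * f (Suc p) (Suc (p + j)))"
          unfolding g_def by (simp add: algebra_simps)
      qed
      also have "\<dots> = of_nat (Suc p) * binomial_sum (Suc l) p f +
          of_nat (2 * l) * binomial_sum (l - 1) (Suc p) f"
        by (simp only: binomial_sum_Suc binomial_sum_absorb)
      finally have "binomial_sum l p g = \<dots>" .
      moreover have "Suc l = Suc m - 2 * p" "l - 1 = Suc m - 2 * Suc p"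
        using True by (simp_all add: l_def)
      ultimately show ?thesis
        unfolding l_def [symmetric] by (simp only: of_nat_mult distrib_left mult_ac)
    qed (simp add: gamma_coeff_eq_0)
  qed
  also have "\<dots> = (\<Sum>p\<le>Suc m. of_nat (gamma_coeff (Suc m) p) * binomial_sum (Suc m - 2 * p) p f)"
  proof -
    \<comment> \<open>This moves the first half of the sum to index \<open>Suc p\<close>, where it
      meets the second half as in the recurrence. The extra top term vanishes with
      \<open>gamma_coeff m (Suc m)\<close>.\<close>
    have *: "(\<Sum>p\<le>m. h p) = h 0 + (\<Sum>p\<le>m. h (Suc p))" if "h (Suc m) = 0" for h :: "nat \<Rightarrow> 'a"
      using sum.atMost_Suc_shift [of h m] that by simp
    show ?thesis
      unfolding sum.distrib
      by (subst *, simp add: gamma_coeff_eq_0, subst sum.atMost_Suc_shift)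
         (simp add: algebra_simps sum.distrib)
  qed
  finally show ?case .
qed

text \<open>For a monomial weight the binomial theorem evaluates each
  \<open>binomial_sum\<close>.\<close>

lemma pk_des_poly_gamma:
  "pk_des_poly (Suc m) y t =
    (\<Sum>p\<le>m. of_nat (gamma_coeff m p) * ((y * t) ^ (p + 1) * (1 + t) ^ (m - 2 * p)))"
proof -
  have "binomial_sum l p (\<lambda>p d. y ^ (p + 1) * t ^ (d + 1)) = (y * t) ^ (p + 1) * (1 + t) ^ l" for l p
    unfolding binomial_sum_def add.commute [of 1 t] binomial_ring sum_distrib_left
    by (intro sum.cong refl) (simp add: power_add power_mult_distrib mult_ac)
  thus ?thesis
    unfolding pk_des_poly_def sum_pk_des_gamma [where f = "\<lambda>p d. y ^ (p + 1) * t ^ (d + 1)"] by simp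
qed

section \<open>The change of variables\<close>

lemma eulerian_poly_eq_pk_des_poly: "eulerian_poly n t = pk_des_poly n 1 t"
  by (simp add: eulerian_poly_def pk_des_poly_def)

text \<open>Stated without division, so that it serves both in the field of rational functions and
  in that of Laurent series.\<close>

lemma pk_des_poly_eq_eulerian_poly:
  fixes y t r v :: "'a::comm_semiring_1"
  assumes "n \<ge> 1" and yt: "y * t = r\<^sup>2 * v" and t: "1 + t = r * (1 + v)"
  shows "pk_des_poly n y t = r ^ (n + 1) * eulerian_poly n v"
proof -
  obtain m where n: "n = Suc m" using assms(1) by (cases n) auto
  have "of_nat (gamma_coeff m p) * ((y * t) ^ (p + 1) * (1 + t) ^ (m - 2 * p)) =
      r ^ (n + 1) * (of_nat (gamma_coeff m p) * ((1 * v) ^ (p + 1) * (1 + v) ^ (m - 2 * p)))" for p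
  proof (cases "2 * p \<le> m")
    case True
    hence "n + 1 = 2 * (p + 1) + (m - 2 * p)" by (simp add: n)
    hence "r ^ (n + 1) = (r\<^sup>2) ^ (p + 1) * r ^ (m - 2 * p)"
      by (simp only: power_add power_mult)
    thus ?thesis
      unfolding yt t by (simp only: power_mult_distrib mult_1_left mult_ac)
  qed (simp add: gamma_coeff_eq_0)
  thus ?thesis
    unfolding eulerian_poly_eq_pk_des_poly n pk_des_poly_gamma sum_distrib_left by (simp add: n)
qed

text \<open>Here \<open>u\<close> and \<open>v\<close> invert the substitution of the first identity:
  \<open>t = (u + v) / (1 + u v)\<close> and \<open>y = (1 + u)\<^sup>2 v / ((u + v) (1 + u v))\<close>.\<close>

lemma rational_parametrization:
  fixes y t s u v :: "'a::field_char_0"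
  assumes s: "s\<^sup>2 = (1 + t)\<^sup>2 - 4 * y * t" and nz: "y \<noteq> 0" "y \<noteq> 1" "t \<noteq> 0" "1 + t \<noteq> 0" "s \<noteq> 0"
    and u: "u = (1 + t\<^sup>2 - 2 * y * t - (1 - t) * s) / (2 * (1 - y) * t)"
    and v: "v = ((1 + t)\<^sup>2 - 2 * y * t - (1 + t) * s) / (2 * y * t)"
  shows "y * t = ((1 + u) / (1 + u * v))\<^sup>2 * v" and "1 + t = (1 + u) / (1 + u * v) * (1 + v)"
proof -
  have v': "2 * y * t * v = (1 + t)\<^sup>2 - 2 * y * t - (1 + t) * s"
    using nz by (simp add: v)
  have u': "2 * (1 - y) * t * u = 1 + t\<^sup>2 - 2 * y * t - (1 - t) * s"
    using nz by (simp add: u)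
  \<comment> \<open>Here \<open>2 * y * t * (1 + v) = (1 + t) * (1 + t - s)\<close>; squaring
    eliminates \<open>s\<close> and yields a quadratic equation for \<open>v\<close>.\<close>
  have "4 * y * t * (y * t * (1 + v)\<^sup>2) = (2 * y * t + 2 * y * t * v)\<^sup>2"
    by algebra
  also have "\<dots> = 4 * y * t * ((1 + t)\<^sup>2 * v)"
    using v' s by algebra
  finally have quad: "y * t * (1 + v)\<^sup>2 = (1 + t)\<^sup>2 * v"
    using nz by simp
  \<comment> \<open>The factor \<open>4 * y * (1 - y) * t\<^sup>2\<close> is the product of the
    denominators of \<open>u\<close> and \<open>v\<close>.\<close>
  have "4 * y * (1 - y) * t\<^sup>2 * (t * (1 + u * v)) = 4 * y * (1 - y) * t\<^sup>2 * (u + v)"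
    using u' v' s by algebra
  hence lin: "t * (1 + u * v) = u + v"
    using nz by simp
  have v1: "1 + v \<noteq> 0"
  proof
    assume "1 + v = 0"
    hence "(1 + t) * (1 + t - s) = 0"
      using v' by algebra
    hence "s = 1 + t" using nz by simp
    with s nz show False by simp
  qed
  \<comment> \<open>Otherwise \<open>u = - v\<close> and \<open>v\<^sup>2 = 1\<close>, so
    \<open>v = 1\<close>. This forces \<open>s = 1 + t\<close>, contrary to
    \<open>4 * y * t \<noteq> 0\<close>.\<close>
  have uv: "1 + u * v \<noteq> 0"
  proof
    assume 0: "1 + u * v = 0"
    hence "u = - v" using lin by (simp add: eq_neg_iff_add_eq_0)
    hence "(1 + v) * (1 - v) = 0" using 0 by algebra
    hence "v = 1" using v1 by simp
    hence "s * (s - (1 + t)) = 0" using v' s by algebra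
    hence "s = 1 + t" using nz by simp
    with s nz show False by simp
  qed
  have 1: "(1 + t) * (1 + u * v) = (1 + u) * (1 + v)"
    using lin by algebra
  have "(1 + v)\<^sup>2 * (y * t * (1 + u * v)\<^sup>2) = (1 + v)\<^sup>2 * ((1 + u)\<^sup>2 * v)"
    using quad 1 by algebra
  hence 2: "y * t * (1 + u * v)\<^sup>2 = (1 + u)\<^sup>2 * v"
    using v1 by simp
  show "1 + t = (1 + u) / (1 + u * v) * (1 + v)"
    using 1 uv by (simp add: field_simps)
  show "y * t = ((1 + u) / (1 + u * v))\<^sup>2 * v"
    using 2 uv by (simp add: power_divide nonzero_eq_divide_eq)
qed

lemma embed_ps_eq_iff: "embed_ps f = embed_ps g \<longleftrightarrow> f = g"
  using inj_embed_ps by (auto dest: injD)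

lemma embed_ps_0: "embed_ps 0 = 0"
  using embed_ps_diff [of 0 0] by simp

theorem theorem4p2:
  fixes n :: nat
  assumes "n \<ge> 1"
  shows
    "eulerian_poly n t_rf =
       ((1 + y_rf * t_rf) / (1 + y_rf)) ^ (n + 1) *
       pk_des_poly n ((1 + y_rf)\<^sup>2 * t_rf / ((y_rf + t_rf) * (1 + y_rf * t_rf)))
                     ((y_rf + t_rf) / (1 + y_rf * t_rf))
     \<and>
     pk_des_poly n y_ls t_ls =
       ((1 + u_ls) / (1 + u_ls * v_ls)) ^ (n + 1) * eulerian_poly n v_ls"
proof
  have one: "1 = (to_fract 1 :: ratfun)" by simp
  \<comment> \<open>Nonvanishing is checked on polynomials, since \<open>to_fract\<close> is
    injective.\<close>
  have nz: "1 + y_rf \<noteq> 0" "y_rf + t_rf \<noteq> 0" "1 + y_rf * t_rf \<noteq> 0"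
    unfolding y_rf_def t_rf_def one
    by (simp_all only: to_fract_add [symmetric] to_fract_mult [symmetric] to_fract_eq_0_iff)
       (simp_all add: one_pCons)
  \<comment> \<open>Here \<open>y_rf\<close> plays the role of \<open>u\<close> and
    \<open>t_rf\<close> that of \<open>v\<close>; \<open>?r\<close> is the reciprocal of the
    prefactor in the claim.\<close>
  let ?r = "(1 + y_rf) / (1 + y_rf * t_rf)"
  have "pk_des_poly n ((1 + y_rf)\<^sup>2 * t_rf / ((y_rf + t_rf) * (1 + y_rf * t_rf)))
      ((y_rf + t_rf) / (1 + y_rf * t_rf)) = ?r ^ (n + 1) * eulerian_poly n t_rf"
  proof (rule pk_des_poly_eq_eulerian_poly [OF assms])
    show "(1 + y_rf)\<^sup>2 * t_rf / ((y_rf + t_rf) * (1 + y_rf * t_rf)) *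
        ((y_rf + t_rf) / (1 + y_rf * t_rf)) = ?r\<^sup>2 * t_rf"
      using nz by (simp add: power_divide power2_eq_square)
    show "1 + (y_rf + t_rf) / (1 + y_rf * t_rf) = ?r * (1 + t_rf)"
      using nz by (simp add: divide_simps) (simp add: algebra_simps)
  qed
  moreover have "((1 + y_rf * t_rf) / (1 + y_rf)) ^ (n + 1) * ?r ^ (n + 1) = 1"
    unfolding power_mult_distrib [symmetric] using nz by simp
  ultimately show "eulerian_poly n t_rf =
       ((1 + y_rf * t_rf) / (1 + y_rf)) ^ (n + 1) *
       pk_des_poly n ((1 + y_rf)\<^sup>2 * t_rf / ((y_rf + t_rf) * (1 + y_rf * t_rf)))
                     ((y_rf + t_rf) / (1 + y_rf * t_rf))"
    by (simp only: mult.assoc [symmetric] mult_1_left)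
next
  have "embed_ps 4 = 4"
    using embed_ps_add [of 2 2] by (simp add: embed_ps_2)
  hence "sqrt_ls\<^sup>2 = (1 + t_ls)\<^sup>2 - 4 * y_ls * t_ls"
    using arg_cong [OF sqrt_ps(1), of embed_ps]
    by (simp add: sqrt_ls_def y_ls_def t_ls_def embed_ps_hom)
  \<comment> \<open>Injectivity of \<open>embed_ps\<close> reduces these to power series; the square
    root is nonzero because its constant term is 1.\<close>
  moreover have "y_ls \<noteq> 0" "y_ls \<noteq> 1" "t_ls \<noteq> 0" "sqrt_ls \<noteq> 0"
    unfolding y_ls_def t_ls_def sqrt_ls_def embed_ps_0 [symmetric] embed_ps_1 [symmetric] embed_ps_eq_iff
    using sqrt_ps(2) by (auto simp: y_ps_def t_ps_def one_pCons fps_eq_iff [of "fps_const _"])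
  moreover have "1 + t_ls \<noteq> 0"
  proof -
    have "1 + t_ps \<noteq> 0"
      by (auto simp: t_ps_def fps_eq_iff intro!: exI [of _ 0])
    thus ?thesis
      unfolding t_ls_def embed_ps_0 [symmetric] embed_ps_1 [symmetric] embed_ps_add [symmetric] embed_ps_eq_iff .
  qed
  ultimately show "pk_des_poly n y_ls t_ls =
       ((1 + u_ls) / (1 + u_ls * v_ls)) ^ (n + 1) * eulerian_poly n v_ls"
    by (intro pk_des_poly_eq_eulerian_poly [OF assms] rational_parametrization [OF _ _ _ _ _ _ u_ls_def v_ls_def])
qed

end
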